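(* Let $\alpha,\beta$ be real numbers with $0<\alpha<\beta<1$ and $0<\beta\le 2-\sqrt{2-\alpha^2}$. For $x\in[0,1]$ define $$\widetilde f(x):=\frac{x(x+b)}{1+b},\qquad b=-\frac{(2-\alpha)^2+\beta^2-2}{2(\beta-\alpha)}.$$ Then $\widetilde f$ is an increasing concave quadratic that satisfies $\widetilde f(0)=0$ and $\widetilde f(1)=1$. Moreover, its residue in the least-squares sense satisfies $$\min_{\substack{0<\alpha\le\beta<1\\ \widetilde f\text{ - quadratic}}}\left(\int_0^1\left(\widetilde f(x)-\left(x\,\widetilde f(\alpha x+1-\alpha)+(1-x)\,\widetilde f(\beta x)\right)\right)^2dx\right)^{\frac12}\le\frac{\beta^2-\alpha^2}{2\sqrt{210}}\le\frac{(2-\sqrt{2-\alpha^2})^2-\alpha^2}{2\sqrt{210}}\le\frac{(2-\sqrt2)^2}{2\sqrt{210}}\approx 0.01.$$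
   Context: The residue is that of the functional equation $f(x)=x f(\alpha x+1-\alpha)+(1-x)f(\beta x)$, $x\in[0,1]$, for an unknown $f:[0,1]\to\mathbb{R}$ with $f(0)=0$, $f(1)=1$, where $0<\alpha\le\beta<1$; the residue of a function is the difference of the two sides of this equation, measured in the $L^2(0,1)$ norm. *)

theory Defs
  imports "HOL-Analysis.Analysis" "HOL-Computational_Algebra.Polynomial"
begin

text \<open>
  Unknown functions live on \<open>[0,1]\<close>; they are represented by total functions on the reals whose
  values outside \<open>{0..1}\<close> are irrelevant. For \<open>0 < \<alpha> \<le> \<beta> < 1\<close> and \<open>x \<in> [0,1]\<close>, the points
  \<open>\<alpha> * x + 1 - \<alpha>\<close> and \<open>\<beta> * x\<close> stay in \<open>[0,1]\<close>.
\<close>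

definition feq_rhs :: "real \<Rightarrow> real \<Rightarrow> (real \<Rightarrow> real) \<Rightarrow> real \<Rightarrow> real" where
  "feq_rhs \<alpha> \<beta> f x = x * f (\<alpha> * x + 1 - \<alpha>) + (1 - x) * f (\<beta> * x)"

definition residue :: "real \<Rightarrow> real \<Rightarrow> (real \<Rightarrow> real) \<Rightarrow> real" where
  "residue \<alpha> \<beta> f = sqrt (integral {0..1} (\<lambda>x. (f x - feq_rhs \<alpha> \<beta> f x)\<^sup>2))"

definition quadratic_on_unit :: "(real \<Rightarrow> real) \<Rightarrow> bool" where
  "quadratic_on_unit f \<longleftrightarrow> (\<exists>p :: real poly. degree p = 2 \<and> (\<forall>x\<in>{0..1}. f x = poly p x))"

text \<open>
  The competitors in the minimisation: the boundary conditions belong to the problem, and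
  without them the residue could be made arbitrarily small by scaling.
\<close>

definition admissible_quadratic :: "(real \<Rightarrow> real) \<Rightarrow> bool" where
  "admissible_quadratic f \<longleftrightarrow> quadratic_on_unit f \<and> f 0 = 0 \<and> f 1 = 1"

definition coeff_b :: "real \<Rightarrow> real \<Rightarrow> real" where
  "coeff_b \<alpha> \<beta> = - (((2 - \<alpha>)\<^sup>2 + \<beta>\<^sup>2 - 2) / (2 * (\<beta> - \<alpha>)))"

definition f_tilde :: "real \<Rightarrow> real \<Rightarrow> real \<Rightarrow> real" where
  "f_tilde \<alpha> \<beta> x = x * (x + coeff_b \<alpha> \<beta>) / (1 + coeff_b \<alpha> \<beta>)"

end

theory Submission imports Defs begin

text \<open>
  A quadratic with \<open>f 0 = 0\<close> and \<open>f 1 = 1\<close> is \<open>c x\<^sup>2 + (1 - c) x\<close>. Its defect in the functional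
  equation vanishes at 0 and 1, so it is \<open>x (1 - x)\<close> times an affine function. Expanding that affine
  function around the midpoint, which is orthogonal for the weight \<open>(x (1 - x))\<^sup>2\<close>, writes the squared
  residue as a sum of two squares in \<open>c\<close>. The coefficient \<open>c\<close> of \<open>f_tilde\<close> is the one that kills
  the first square, and the bound on \<open>\<beta>\<close> says exactly that \<open>\<bar>c\<bar> \<le> 1\<close>.
\<close>

text \<open>In \<open>p + r * x = (p + r / 2) + r * (x - 1 / 2)\<close> the cross term integrates to
  zero by symmetry about the midpoint. The constants 1/30 and 1/840 are the integrals of
  \<open>(x * (1 - x))\<^sup>2\<close> and of the same weight times
  \<open>(x - 1 / 2)\<^sup>2\<close>.\<close>

lemma has_integral_weighted_affine_square:
  fixes p r :: real
  shows "((\<lambda>x. (x * (1 - x) * (p + r * x))\<^sup>2) has_integral (p + r / 2)\<^sup>2 / 30 + r\<^sup>2 / 840) {0..1}"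
proof -
  define F where "F = (\<lambda>x::real. p\<^sup>2 * (x^3/3 - x^4/2 + x^5/5)
    + 2 * p * r * (x^4/4 - 2 * x^5/5 + x^6/6) + r\<^sup>2 * (x^5/5 - x^6/3 + x^7/7))"
  have "(F has_vector_derivative (x * (1 - x) * (p + r * x))\<^sup>2) (at x within {0..1})" for x
    unfolding F_def has_real_derivative_iff_has_vector_derivative[symmetric]
    by (rule derivative_eq_intros refl | simp)+ (simp add: algebra_simps eval_nat_numeral)
  then have "((\<lambda>x. (x * (1 - x) * (p + r * x))\<^sup>2) has_integral (F 1 - F 0)) {0..1}"
    by (intro fundamental_theorem_of_calculus) auto
  moreover have "F 1 - F 0 = (p + r / 2)\<^sup>2 / 30 + r\<^sup>2 / 840"
    by (simp add: F_def power2_eq_square field_simps)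
  ultimately show ?thesis by simp
qed

lemma residue_quadratic:
  fixes \<alpha> \<beta> c :: real
  assumes "0 \<le> \<alpha>" "\<alpha> \<le> 1" "0 \<le> \<beta>" "\<beta> \<le> 1"
    and f: "\<And>x. x \<in> {0..1} \<Longrightarrow> f x = c * x\<^sup>2 + (1 - c) * x"
  shows "residue \<alpha> \<beta> f =
    sqrt ((\<beta> - \<alpha> + c * (((1 - \<alpha>)\<^sup>2 + (1 - \<beta>)\<^sup>2) / 2))\<^sup>2 / 30 + (c * (\<beta>\<^sup>2 - \<alpha>\<^sup>2))\<^sup>2 / 840)"
proof -
  \<comment> \<open>\<open>p + r * x\<close> is the quotient of the defect by
    \<open>- x * (1 - x)\<close>.\<close>
  define p where "p = \<beta> - \<alpha> + c * ((1 - \<alpha>)\<^sup>2 - (\<beta> - \<alpha>))"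
  define r where "r = c * (\<beta>\<^sup>2 - \<alpha>\<^sup>2)"
  have "(f x - feq_rhs \<alpha> \<beta> f x)\<^sup>2 = (x * (1 - x) * (p + r * x))\<^sup>2" if x: "x \<in> {0..1}" for x
  proof -
    \<comment> \<open>The formula for \<open>f\<close> is available only on the unit interval, so
      both inner arguments must be placed there; the first one is
      \<open>1 - \<alpha> * (1 - x)\<close>.\<close>
    have "0 \<le> \<alpha> * x" "\<alpha> * (1 - x) \<le> 1 * 1" "0 \<le> \<beta> * x" "\<beta> * x \<le> 1 * 1" "0 \<le> \<alpha> * (1 - x)"
      using assms(1-4) x by (intro mult_mono mult_nonneg_nonneg; simp)+
    then have "\<alpha> * x + 1 - \<alpha> \<in> {0..1}" "\<beta> * x \<in> {0..1}"
      using assms by (auto simp: algebra_simps)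
    then have "f x - feq_rhs \<alpha> \<beta> f x = - (x * (1 - x) * (p + r * x))"
      unfolding feq_rhs_def f[OF x] f[OF \<open>\<alpha> * x + 1 - \<alpha> \<in> {0..1}\<close>] f[OF \<open>\<beta> * x \<in> {0..1}\<close>]
      by (simp add: p_def r_def power2_eq_square algebra_simps)
    then show ?thesis by simp
  qed
  then have "residue \<alpha> \<beta> f = sqrt (integral {0..1} (\<lambda>x. (x * (1 - x) * (p + r * x))\<^sup>2))"
    unfolding residue_def by (metis (no_types, lifting) Henstock_Kurzweil_Integration.integral_cong)
  also have "\<dots> = sqrt ((p + r / 2)\<^sup>2 / 30 + r\<^sup>2 / 840)"
    using has_integral_weighted_affine_square[of p r] by (simp add: integral_unique)
  also have "p + r / 2 = \<beta> - \<alpha> + c * (((1 - \<alpha>)\<^sup>2 + (1 - \<beta>)\<^sup>2) / 2)"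
    by (simp add: p_def r_def power2_eq_square field_simps)
  finally show ?thesis by (simp add: r_def)
qed

lemma quadratic_on_unitI:
  assumes "a \<noteq> 0" and "\<And>x. x \<in> {0..1} \<Longrightarrow> f x = a * x\<^sup>2 + b * x + c"
  shows "quadratic_on_unit f"
  unfolding quadratic_on_unit_def
  using assms by (intro exI[of _ "[:c, b, a:]"]) (auto simp: power2_eq_square algebra_simps)

lemma quadratic_on_unitE:
  assumes "quadratic_on_unit f"
  obtains a b c where "a \<noteq> 0" "\<And>x. x \<in> {0..1} \<Longrightarrow> f x = a * x\<^sup>2 + b * x + c"
proof -
  obtain p :: "real poly" where p: "degree p = 2" "\<And>x. x \<in> {0..1} \<Longrightarrow> f x = poly p x"
    using assms unfolding quadratic_on_unit_def by blast
  have "coeff p 2 \<noteq> 0"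
    using p(1) by (metis degree_0 leading_coeff_0_iff zero_neq_numeral)
  moreover have "poly p x = coeff p 2 * x\<^sup>2 + coeff p 1 * x + coeff p 0" for x
    by (simp add: poly_altdef p(1) numeral_2_eq_2 algebra_simps)
  ultimately show thesis using that[of "coeff p 2"] p(2) by simp
qed

text \<open>The two boundary values fix the constant and linear coefficients, so minimising over
  competitors becomes minimising over one nonzero real.\<close>

lemma admissible_quadraticE:
  assumes "admissible_quadratic f"
  obtains c where "c \<noteq> 0" "\<And>x. x \<in> {0..1} \<Longrightarrow> f x = c * x\<^sup>2 + (1 - c) * x"
proof -
  have f: "quadratic_on_unit f" "f 0 = 0" "f 1 = 1"
    using assms by (auto simp: admissible_quadratic_def)
  obtain a b c where abc: "a \<noteq> 0" "\<And>x. x \<in> {0..1} \<Longrightarrow> f x = a * x\<^sup>2 + b * x + c"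
    using quadratic_on_unitE[OF f(1)] by metis
  have "c = 0" "b = 1 - a"
    using abc(2)[of 0] abc(2)[of 1] f(2,3) by auto
  with abc that[of a] show thesis by simp
qed

text \<open>Completing the square: the right-hand side is a quadratic in \<open>t\<close> with
  leading coefficient \<open>m\<^sup>2 * k + l > 0\<close>, and it exceeds its value at the vertex
  \<open>c\<close> by exactly \<open>(t - c)\<^sup>2 * (m\<^sup>2 * k + l)\<close>.\<close>

lemma sum_two_squares_minimum:
  fixes d m k l t c :: real
  assumes "k > 0" "l \<ge> 0" "m \<noteq> 0"
  defines "c \<equiv> - (d * m * k) / (m\<^sup>2 * k + l)"
  shows "(d + c * m)\<^sup>2 * k + c\<^sup>2 * l \<le> (d + t * m)\<^sup>2 * k + t\<^sup>2 * l"
proof -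
  define A where "A = m\<^sup>2 * k + l"
  have "A > 0" unfolding A_def using assms by (simp add: add_pos_nonneg)
  then have c: "c * A = - (d * m * k)" by (simp add: c_def A_def)
  have expand: "(d + s * m)\<^sup>2 * k + s\<^sup>2 * l = d\<^sup>2 * k + 2 * s * (d * m * k) + s\<^sup>2 * A" for s
    by (simp add: A_def power2_eq_square algebra_simps)
  have "((d + t * m)\<^sup>2 * k + t\<^sup>2 * l) - ((d + c * m)\<^sup>2 * k + c\<^sup>2 * l)
      = 2 * (t - c) * (d * m * k) + (t\<^sup>2 - c\<^sup>2) * A"
    unfolding expand by (simp add: algebra_simps)
  also have "\<dots> = 2 * (t - c) * - (c * A) + (t\<^sup>2 - c\<^sup>2) * A"
    unfolding c by simp
  also have "\<dots> = (t - c)\<^sup>2 * A"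
    by (simp add: power2_eq_square algebra_simps)
  also have "\<dots> \<ge> 0" using \<open>A > 0\<close> by simp
  finally show ?thesis by simp
qed

lemma ex_residue_minimizer:
  fixes \<alpha> \<beta> :: real
  assumes "0 < \<alpha>" "\<alpha> < \<beta>" "\<beta> < 1"
  shows "\<exists>q. is_arg_min (residue \<alpha> \<beta>) admissible_quadratic q"
proof -
  define m where "m = ((1 - \<alpha>)\<^sup>2 + (1 - \<beta>)\<^sup>2) / 2"
  define l where "l = (\<beta>\<^sup>2 - \<alpha>\<^sup>2)\<^sup>2 / 840"
  \<comment> \<open>The vertex from \<open>sum_two_squares_minimum\<close> with
    \<open>k = 1 / 30\<close>. The coefficient of \<open>f_tilde\<close> is what this becomes when
    \<open>l\<close> is replaced by 0.\<close>
  define c where "c = - ((\<beta> - \<alpha>) * m * (1 / 30)) / (m\<^sup>2 * (1 / 30) + l)"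
  define q where "q = (\<lambda>x. c * x\<^sup>2 + (1 - c) * x)"
  have "m > 0" unfolding m_def using assms by (simp add: add_pos_pos)
  have "l \<ge> 0" by (simp add: l_def)
  have "m\<^sup>2 * (1 / 30) + l > 0" using \<open>m > 0\<close> \<open>l \<ge> 0\<close> by (simp add: add_pos_nonneg)
  \<comment> \<open>The vertex must avoid 0, where \<open>q\<close> would degenerate to a linear
    function; this uses \<alpha> < \<beta>.\<close>
  then have "c \<noteq> 0" using \<open>m > 0\<close> assms by (simp add: c_def)
  then have "quadratic_on_unit q" by (rule quadratic_on_unitI[where b = "1 - c" and c = 0]) (simp add: q_def)
  then have adm: "admissible_quadratic q" by (simp add: admissible_quadratic_def q_def)
  have res: "residue \<alpha> \<beta> f = sqrt ((\<beta> - \<alpha> + t * m)\<^sup>2 * (1 / 30) + t\<^sup>2 * l)"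
    if "\<And>x. x \<in> {0..1} \<Longrightarrow> f x = t * x\<^sup>2 + (1 - t) * x" for f t
    using residue_quadratic[of \<alpha> \<beta> f t] that assms by (simp add: m_def l_def power_mult_distrib)
  have "residue \<alpha> \<beta> q \<le> residue \<alpha> \<beta> f" if f: "admissible_quadratic f" for f
  proof -
    obtain t where t: "\<And>x. x \<in> {0..1} \<Longrightarrow> f x = t * x\<^sup>2 + (1 - t) * x"
      using admissible_quadraticE[OF f] by metis
    have "residue \<alpha> \<beta> q = sqrt ((\<beta> - \<alpha> + c * m)\<^sup>2 * (1 / 30) + c\<^sup>2 * l)"
      by (rule res) (simp add: q_def)
    also have "\<dots> \<le> sqrt ((\<beta> - \<alpha> + t * m)\<^sup>2 * (1 / 30) + t\<^sup>2 * l)"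
      unfolding c_def using \<open>m > 0\<close> \<open>l \<ge> 0\<close>
      by (intro real_sqrt_le_mono sum_two_squares_minimum) auto
    also have "\<dots> = residue \<alpha> \<beta> f" using res[OF t] by simp
    finally show ?thesis .
  qed
  then show ?thesis using adm unfolding is_arg_min_def by (metis not_less)
qed

lemma residue_nonneg: "0 \<le> residue \<alpha> \<beta> f"
  unfolding residue_def
  \<comment> \<open>For a non-integrable integrand the integral takes the default value 0.\<close>
  by (cases "(\<lambda>x. (f x - feq_rhs \<alpha> \<beta> f x)\<^sup>2) integrable_on {0..1}")
    (simp_all add: integral_nonneg not_integrable_integral)

text \<open>The increment from \<open>x\<close> to \<open>y\<close> factors as
  \<open>(y - x) * (1 + c * (x + y - 1))\<close>. The second factor stays positive even for
  \<open>c = -1\<close>, where the derivative vanishes at 1, because \<open>x < y\<close> forces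
  \<open>x + y < 2\<close>.\<close>

lemma strict_mono_on_quadratic:
  fixes c :: real
  assumes "-1 \<le> c" "c < 0"
  shows "strict_mono_on {0..1} (\<lambda>x. c * x\<^sup>2 + (1 - c) * x)"
proof (rule strict_mono_onI)
  fix x y :: real
  assume xy: "x \<in> {0..1}" "y \<in> {0..1}" "x < y"
  have "(-c) * (x + y - 1) < 1"
  proof (cases "x + y \<le> 1")
    case True
    then have "(-c) * (x + y - 1) \<le> 0"
      using assms by (intro mult_nonneg_nonpos) auto
    then show ?thesis by simp
  next
    case False
    then have "(-c) * (x + y - 1) \<le> 1 * (x + y - 1)"
      using assms by (intro mult_right_mono) auto
    also have "\<dots> < 1" using xy by auto
    finally show ?thesis .
  qed
  then have "0 < (y - x) * (1 + c * (x + y - 1))"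
    using xy by (intro mult_pos_pos) auto
  also have "\<dots> = (c * y\<^sup>2 + (1 - c) * y) - (c * x\<^sup>2 + (1 - c) * x)"
    by (simp add: power2_eq_square algebra_simps)
  finally show "c * x\<^sup>2 + (1 - c) * x < c * y\<^sup>2 + (1 - c) * y" by simp
qed

lemma concave_on_quadratic:
  fixes a b :: real
  assumes "a \<le> 0" "convex S"
  shows "concave_on S (\<lambda>x. a * x\<^sup>2 + b * x)"
  unfolding concave_on_def
proof (rule convex_onI)
  fix t x y :: real
  assume "0 < t" "t < 1"
  \<comment> \<open>This is the exact gap in the convexity inequality for the negated
    quadratic.\<close>
  then have "0 \<le> (-a) * (t * (1 - t) * (x - y)\<^sup>2)"
    using assms by (intro mult_nonneg_nonneg) auto
  also have "\<dots> = ((1 - t) * - (a * x\<^sup>2 + b * x) + t * - (a * y\<^sup>2 + b * y))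
      - - (a * ((1 - t) *\<^sub>R x + t *\<^sub>R y)\<^sup>2 + b * ((1 - t) *\<^sub>R x + t *\<^sub>R y))"
    by (simp add: power2_eq_square algebra_simps)
  finally show "- (a * ((1 - t) *\<^sub>R x + t *\<^sub>R y)\<^sup>2 + b * ((1 - t) *\<^sub>R x + t *\<^sub>R y))
      \<le> (1 - t) * - (a * x\<^sup>2 + b * x) + t * - (a * y\<^sup>2 + b * y)" by simp
qed (fact assms)

text \<open>The leading coefficient is \<open>1 / (1 + coeff_b \<alpha> \<beta>)\<close>, and
  \<open>(2 - \<alpha>)\<^sup>2 + \<beta>\<^sup>2 - 2 - 2 * (\<beta> - \<alpha>)\<close> equals
  \<open>(1 - \<alpha>)\<^sup>2 + (1 - \<beta>)\<^sup>2\<close>.\<close>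

lemma f_tilde_eq:
  fixes \<alpha> \<beta> :: real
  assumes "\<alpha> < \<beta>" "\<beta> < 1"
  defines "c \<equiv> - (2 * (\<beta> - \<alpha>) / ((1 - \<alpha>)\<^sup>2 + (1 - \<beta>)\<^sup>2))"
  shows "f_tilde \<alpha> \<beta> = (\<lambda>x. c * x\<^sup>2 + (1 - c) * x)"
proof
  fix x
  define b where "b = coeff_b \<alpha> \<beta>"
  have pos: "(1 - \<alpha>)\<^sup>2 + (1 - \<beta>)\<^sup>2 > 0" using assms by (simp add: add_pos_pos)
  have b: "1 + b = - (((1 - \<alpha>)\<^sup>2 + (1 - \<beta>)\<^sup>2) / (2 * (\<beta> - \<alpha>)))"
    using assms by (simp add: b_def coeff_b_def power2_eq_square field_simps)
  then have "c = 1 / (1 + b)" and "1 + b \<noteq> 0"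
    using pos assms by (simp_all add: c_def)
  then have "1 - c = b / (1 + b)" by (simp add: field_simps)
  then show "f_tilde \<alpha> \<beta> x = c * x\<^sup>2 + (1 - c) * x"
    unfolding f_tilde_def b_def[symmetric] \<open>1 - c = b / (1 + b)\<close>
    by (simp add: \<open>c = 1 / (1 + b)\<close> power2_eq_square add_divide_distrib distrib_left mult.commute)
qed

text \<open>For fixed parameters the minimum is attained. Over all parameters it is only an infimum:
  at \<alpha> = \<beta> the residue tends to 0 with the leading coefficient, which itself may not be
  0.\<close>

theorem theorem4:
  fixes \<alpha> \<beta> :: real
  assumes "0 < \<alpha>" and "\<alpha> < \<beta>" and "\<beta> < 1"
    and "0 < \<beta>" and "\<beta> \<le> 2 - sqrt (2 - \<alpha>\<^sup>2)"
  shows "quadratic_on_unit (f_tilde \<alpha> \<beta>)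
    \<and> strict_mono_on {0..1} (f_tilde \<alpha> \<beta>)
    \<and> concave_on {0..1} (f_tilde \<alpha> \<beta>)
    \<and> f_tilde \<alpha> \<beta> 0 = 0 \<and> f_tilde \<alpha> \<beta> 1 = 1
    \<and> (\<exists>q. is_arg_min (residue \<alpha> \<beta>) admissible_quadratic q
          \<and> Inf {residue a b f | a b f. 0 < a \<and> a \<le> b \<and> b < 1 \<and> admissible_quadratic f}
              \<le> residue \<alpha> \<beta> q
          \<and> residue \<alpha> \<beta> q \<le> residue \<alpha> \<beta> (f_tilde \<alpha> \<beta>))
    \<and> residue \<alpha> \<beta> (f_tilde \<alpha> \<beta>) \<le> (\<beta>\<^sup>2 - \<alpha>\<^sup>2) / (2 * sqrt 210)
    \<and> (\<beta>\<^sup>2 - \<alpha>\<^sup>2) / (2 * sqrt 210)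
        \<le> ((2 - sqrt (2 - \<alpha>\<^sup>2))\<^sup>2 - \<alpha>\<^sup>2) / (2 * sqrt 210)
    \<and> ((2 - sqrt (2 - \<alpha>\<^sup>2))\<^sup>2 - \<alpha>\<^sup>2) / (2 * sqrt 210)
        \<le> (2 - sqrt 2)\<^sup>2 / (2 * sqrt 210)
    \<and> \<bar>(2 - sqrt 2)\<^sup>2 / (2 * sqrt 210) - 0.01\<bar> < 0.005"
proof -
  define n where "n = (1 - \<alpha>)\<^sup>2 + (1 - \<beta>)\<^sup>2"
  define c where "c = - (2 * (\<beta> - \<alpha>) / n)"
  define s where "s = sqrt (2 - \<alpha>\<^sup>2)"
  have \<alpha>1: "\<alpha>\<^sup>2 \<le> 1" using assms by (simp add: power_le_one)
  then have s: "s\<^sup>2 = 2 - \<alpha>\<^sup>2" "1 \<le> s" "s \<le> sqrt 2" by (simp_all add: s_def)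
  have "\<beta> \<le> 2 - s" using assms by (simp add: s_def)
  have "n > 0" unfolding n_def using assms by (simp add: add_pos_pos)
  \<comment> \<open>Substituting \<open>s\<^sup>2 = 2 - \<alpha>\<^sup>2\<close> and rearranging
    turns this into \<open>2 * (\<beta> - \<alpha>) \<le> n\<close>, that is,
    \<open>-1 \<le> c\<close>.\<close>
  have "s\<^sup>2 \<le> (2 - \<beta>)\<^sup>2" using \<open>\<beta> \<le> 2 - s\<close> s by (intro power_mono) auto
  then have "2 * (\<beta> - \<alpha>) \<le> n" using s by (simp add: n_def power2_eq_square algebra_simps)
  with \<open>n > 0\<close> assms have c: "-1 \<le> c" "c < 0" by (simp_all add: c_def)
  have f: "f_tilde \<alpha> \<beta> = (\<lambda>x. c * x\<^sup>2 + (1 - c) * x)"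
    using f_tilde_eq[of \<alpha> \<beta>] assms by (simp add: c_def n_def)
  have quad: "quadratic_on_unit (f_tilde \<alpha> \<beta>)"
    using c by (intro quadratic_on_unitI[where a = c and b = "1 - c" and c = 0]) (simp_all add: f)
  have bnd: "f_tilde \<alpha> \<beta> 0 = 0" "f_tilde \<alpha> \<beta> 1 = 1" by (simp_all add: f)
  obtain q where q: "is_arg_min (residue \<alpha> \<beta>) admissible_quadratic q"
    using ex_residue_minimizer assms by blast
  have "residue \<alpha> \<beta> q \<le> residue \<alpha> \<beta> (f_tilde \<alpha> \<beta>)"
    using q quad bnd by (auto simp: is_arg_min_def admissible_quadratic_def not_less)
  moreover have "Inf {residue a b f | a b f. 0 < a \<and> a \<le> b \<and> b < 1 \<and> admissible_quadratic f}
      \<le> residue \<alpha> \<beta> q"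
  proof (rule cInf_lower)
    show "residue \<alpha> \<beta> q \<in> {residue a b f | a b f. 0 < a \<and> a \<le> b \<and> b < 1 \<and> admissible_quadratic f}"
      using q assms by (force simp: is_arg_min_def)
  qed (auto intro!: bdd_belowI[of _ 0] residue_nonneg)
  ultimately have min: "\<exists>q. is_arg_min (residue \<alpha> \<beta>) admissible_quadratic q
      \<and> Inf {residue a b f | a b f. 0 < a \<and> a \<le> b \<and> b < 1 \<and> admissible_quadratic f}
          \<le> residue \<alpha> \<beta> q
      \<and> residue \<alpha> \<beta> q \<le> residue \<alpha> \<beta> (f_tilde \<alpha> \<beta>)"
    using q by blast
  have D: "\<beta>\<^sup>2 - \<alpha>\<^sup>2 \<ge> 0" using assms by (simp add: power_mono)
  \<comment> \<open>The affine factor vanishes at the midpoint, so only its slope contributes to the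
    residue.\<close>
  have "\<beta> - \<alpha> + c * (n / 2) = 0" using \<open>n > 0\<close> by (simp add: c_def field_simps)
  then have "residue \<alpha> \<beta> (f_tilde \<alpha> \<beta>) = sqrt ((c * (\<beta>\<^sup>2 - \<alpha>\<^sup>2))\<^sup>2 / 840)"
    using residue_quadratic[of \<alpha> \<beta> "f_tilde \<alpha> \<beta>" c] assms f by (simp add: n_def)
  also have "\<dots> = \<bar>c\<bar> * (\<beta>\<^sup>2 - \<alpha>\<^sup>2) / (2 * sqrt 210)"
  proof -
    have "sqrt 840 = 2 * sqrt 210" using real_sqrt_mult[of 4 210] by simp
    then show ?thesis using D by (simp add: real_sqrt_divide abs_mult)
  qed
  also have "\<dots> \<le> 1 * (\<beta>\<^sup>2 - \<alpha>\<^sup>2) / (2 * sqrt 210)"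
    using c D by (intro divide_right_mono mult_right_mono) auto
  finally have res: "residue \<alpha> \<beta> (f_tilde \<alpha> \<beta>) \<le> (\<beta>\<^sup>2 - \<alpha>\<^sup>2) / (2 * sqrt 210)" by simp
  have "\<beta>\<^sup>2 \<le> (2 - s)\<^sup>2" using \<open>\<beta> \<le> 2 - s\<close> assms by (intro power_mono) auto
  then have ineq2: "(\<beta>\<^sup>2 - \<alpha>\<^sup>2) / (2 * sqrt 210) \<le> ((2 - s)\<^sup>2 - \<alpha>\<^sup>2) / (2 * sqrt 210)"
    by (intro divide_right_mono) auto
  \<comment> \<open>Eliminating \<alpha> through \<open>\<alpha>\<^sup>2 = 2 - s\<^sup>2\<close>
    leaves an expression increasing in \<open>s \<ge> 1\<close>, hence largest at
    \<open>s = sqrt 2\<close>, the limiting case \<alpha> = 0.\<close>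
  have "(2 - s)\<^sup>2 - \<alpha>\<^sup>2 = 2 * (s - 1)\<^sup>2"
    using s(1) by (simp add: power2_eq_square algebra_simps)
  also have "\<dots> \<le> 2 * (sqrt 2 - 1)\<^sup>2" using s by simp
  also have "\<dots> = (2 - sqrt 2)\<^sup>2" by (simp add: power2_eq_square algebra_simps)
  finally have ineq3: "((2 - s)\<^sup>2 - \<alpha>\<^sup>2) / (2 * sqrt 210) \<le> (2 - sqrt 2)\<^sup>2 / (2 * sqrt 210)"
    by (intro divide_right_mono) auto
  \<comment> \<open>These enclosures put \<open>6 - 4 * sqrt 2\<close> between 0.32 and 0.36, while
    the required bounds are at most 0.15 below and at least 0.42 above.\<close>
  have sqrt2: "141 / 100 \<le> sqrt 2" "sqrt 2 \<le> 142 / 100"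
    by (rule real_le_rsqrt real_le_lsqrt; simp add: power2_eq_square)+
  have sqrt210: "14 \<le> sqrt 210" "sqrt 210 \<le> 15"
    by (rule real_le_rsqrt real_le_lsqrt; simp add: power2_eq_square)+
  have "(2 - sqrt 2)\<^sup>2 = 6 - 4 * sqrt 2" by (simp add: power2_eq_square algebra_simps)
  then have "1 / 200 * (2 * sqrt 210) < (2 - sqrt 2)\<^sup>2" "(2 - sqrt 2)\<^sup>2 < 3 / 200 * (2 * sqrt 210)"
    using sqrt2 sqrt210 by linarith+
  then have "1 / 200 < (2 - sqrt 2)\<^sup>2 / (2 * sqrt 210)" "(2 - sqrt 2)\<^sup>2 / (2 * sqrt 210) < 3 / 200"
    by (simp_all add: pos_less_divide_eq divide_less_eq field_simps)
  then have num: "\<bar>(2 - sqrt 2)\<^sup>2 / (2 * sqrt 210) - 0.01\<bar> < 0.005"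
    unfolding abs_less_iff by simp
  have "strict_mono_on {0..1} (f_tilde \<alpha> \<beta>)" "concave_on {0..1} (f_tilde \<alpha> \<beta>)"
    unfolding f using c by (simp_all add: strict_mono_on_quadratic concave_on_quadratic)
  with quad bnd min res ineq2 ineq3 num show ?thesis
    unfolding s_def by blast
qed

end
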